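(* Let $\mu\in\{0,\dots,T-1\}$, $t\in\{1,\dots,T\}$ and $t'\ge t$ ($t'\in\mathcal{P}$). In $(AMS_\mu)$, the non-anticipativity constraints (C) for a particular combination $(t',t)$ become redundant if $t'>t+(T-\mu)-1$. Consequently, the constraints (C) reduce to $$x_{im}\ge x_{in}-\bar{x}_i\left(r_{it'}-r_{it}\right)\quad\text{and}\quad x_{im}\le x_{in}+\bar{x}_i\left(r_{it'}-r_{it}\right)$$ for all $m,n\in S_{t'}\cap\mathcal{T}(l)$, $l\in S_t$, $\min(t+(T-\mu)-1,\,T)\ge t'\ge t$, $t\in\mathcal{P}$, $i\in\mathcal{I}$; i.e. the formulation obtained from $(AMS_\mu)$ by replacing (C) by these constraints is equivalent to $(AMS_\mu)$.
   Context: A scenario tree $\mathcal{T}$ has $T$ stages, $\mathcal{P}=\{1,\dots,T\}$; every non-leaf node has $B$ children. $S_t$ is the set of nodes of stage $t$, $P(n)$ is the set of nodes on the path from the root to $n$ (inclusive), and $\mathcal{T}(l)$ is the subtree rooted at node $l$. Node $n$ has probability $p_n$. At each node $n$ there are state variables $\mathbf{x}_n=(x_{1n},\dots,x_{In})$ and stage variables $\mathbf{y}_n$ (integer or continuous); $\mathcal{I}=\{1,\dots,I\}$. Data: $\mathbf{a}_n,\mathbf{b}_n,\mathbf{C}_{nm},\mathbf{D}_n,\mathbf{d}_n$ and local sets $\mathcal{X}_n,\mathcal{Y}_n$. State variables satisfy $0\le x_{in}\le\bar{x}_i$, where $\bar{x}_i$ is a given upper bound; these bounds are implied by $\mathbf{x}_n\in\mathcal{X}_n$.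 $(AMS_\mu)$, for $\mu\in\{0,\dots,T-1\}$: minimize $\sum_{n\in\mathcal{T}}p_n(\mathbf{a}_n^\top\mathbf{x}_n+\mathbf{b}_n^\top\mathbf{y}_n)$ over $(\mathbf{x},\mathbf{y},\mathbf{r})$ subject to (A) $\sum_{m\in P(n)}\mathbf{C}_{nm}\mathbf{x}_m+\mathbf{D}_n\mathbf{y}_n\ge\mathbf{d}_n$ for all $n\in\mathcal{T}$; (B) $\mathbf{x}_n\in\mathcal{X}_n,\ \mathbf{y}_n\in\mathcal{Y}_n$ for all $n\in\mathcal{T}$; (C) (non-anticipativity constraints) $x_{im}\ge x_{in}-\bar{x}_i(r_{it'}-r_{it})$ and $x_{im}\le x_{in}+\bar{x}_i(r_{it'}-r_{it})$ for all $m,n\in S_{t'}\cap\mathcal{T}(l)$, $l\in S_t$, $t'\ge t$, $t,t'\in\mathcal{P}$, $i\in\mathcal{I}$; (D) $r_{i1}\le r_{i2}\le\dots\le r_{iT}\le\mu$; $r_{i(t+1)}-r_{it}\le1$ for $t\in\{1,\dots,T-1\}$; $r_{i1}=0$; $r_{it}\in\mathbb{Z}_{+}$, for all $i\in\mathcal{I}$, $t\in\mathcal{P}$. Two formulations with this same objective are called equivalent if the same pairs $(\mathbf{x},\mathbf{y})$ are feasible for both, each together with some $\mathbf{r}$ (possibly different); hence they have the same optimal value. Constraints are redundant if deleting them yields an equivalent formulation. *)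

theory Defs
  imports Jordan_Normal_Form.Matrix
begin

text \<open>An edge \<open>(m, n)\<close> means that \<open>n\<close> is a child of \<open>m\<close>.\<close>

record 'n tree =
  nodes :: "'n set"
  edges :: "('n \<times> 'n) set"
  root_node :: 'n
  stages :: nat
  branching :: nat
  node_prob :: "'n \<Rightarrow> real"

definition path_to :: "('n, 'z) tree_scheme \<Rightarrow> 'n \<Rightarrow> 'n set" where
  "path_to P n = {m \<in> nodes P. (m, n) \<in> (edges P)\<^sup>*}"

definition subtree :: "('n, 'z) tree_scheme \<Rightarrow> 'n \<Rightarrow> 'n set" where
  "subtree P l = {n \<in> nodes P. (l, n) \<in> (edges P)\<^sup>*}"

text \<open>Stages are numbered from 1: the root is the only node of stage 1.\<close>

definition stage :: "('n, 'z) tree_scheme \<Rightarrow> 'n \<Rightarrow> nat" where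
  "stage P n = card (path_to P n)"

definition stage_nodes :: "('n, 'z) tree_scheme \<Rightarrow> nat \<Rightarrow> 'n set" where
  "stage_nodes P t = {n \<in> nodes P. stage P n = t}"

definition scenario_tree :: "('n, 'z) tree_scheme \<Rightarrow> bool" where
  "scenario_tree P \<longleftrightarrow>
     finite (nodes P) \<and>
     edges P \<subseteq> nodes P \<times> nodes P \<and>
     root_node P \<in> nodes P \<and>
     (\<forall>m. (m, root_node P) \<notin> edges P) \<and>
     (\<forall>n \<in> nodes P - {root_node P}. \<exists>!m. (m, n) \<in> edges P) \<and>
     (\<forall>n \<in> nodes P. (root_node P, n) \<in> (edges P)\<^sup>*) \<and>
     branching P \<ge> 1 \<and>
     (\<forall>n \<in> nodes P. stage P n \<le> stages P) \<and>
     (\<forall>n \<in> nodes P. stage P n < stages P \<longrightarrow> card (edges P `` {n}) = branching P) \<and>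
     (\<forall>n \<in> nodes P. node_prob P n \<ge> 0) \<and>
     (\<forall>t \<in> {1..stages P}. (\<Sum>n \<in> stage_nodes P t. node_prob P n) = 1)"

text \<open>
  State variables are indexed by \<open>{..<num_states P}\<close>, following the indexing of vectors.
  The number of stage variables of node \<open>n\<close> is the dimension of \<open>b\<^sub>n\<close>, and its number of
  constraints is the dimension of \<open>d\<^sub>n\<close>; both may depend on the node. Integrality
  requirements are part of the local sets.
\<close>

record 'n ams_data = "'n tree" +
  num_states :: nat
  state_cost :: "'n \<Rightarrow> real vec"
  stage_cost :: "'n \<Rightarrow> real vec"
  state_mat :: "'n \<Rightarrow> 'n \<Rightarrow> real mat"
  stage_mat :: "'n \<Rightarrow> real mat"
  rhs :: "'n \<Rightarrow> real vec"
  state_set :: "'n \<Rightarrow> real vec set"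
  stage_set :: "'n \<Rightarrow> real vec set"
  state_ub :: "nat \<Rightarrow> real"

definition ams_instance :: "('n, 'z) ams_data_scheme \<Rightarrow> bool" where
  "ams_instance P \<longleftrightarrow>
     scenario_tree P \<and>
     (\<forall>n \<in> nodes P.
        state_cost P n \<in> carrier_vec (num_states P) \<and>
        (\<forall>m \<in> path_to P n.
           state_mat P n m \<in> carrier_mat (dim_vec (rhs P n)) (num_states P)) \<and>
        stage_mat P n \<in> carrier_mat (dim_vec (rhs P n)) (dim_vec (stage_cost P n)) \<and>
        state_set P n \<subseteq> carrier_vec (num_states P) \<and>
        stage_set P n \<subseteq> carrier_vec (dim_vec (stage_cost P n)) \<and>
        (\<forall>v \<in> state_set P n. \<forall>i < num_states P. 0 \<le> v $ i \<and> v $ i \<le> state_ub P i))"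

definition linear_constraints ::
  "('n, 'z) ams_data_scheme \<Rightarrow> ('n \<Rightarrow> real vec) \<Rightarrow> ('n \<Rightarrow> real vec) \<Rightarrow> bool" where
  "linear_constraints P x y \<longleftrightarrow>
     (\<forall>n \<in> nodes P. \<forall>j < dim_vec (rhs P n).
        (\<Sum>m \<in> path_to P n. (state_mat P n m *\<^sub>v x m) $ j) + (stage_mat P n *\<^sub>v y n) $ j
          \<ge> rhs P n $ j)"

definition local_constraints ::
  "('n, 'z) ams_data_scheme \<Rightarrow> ('n \<Rightarrow> real vec) \<Rightarrow> ('n \<Rightarrow> real vec) \<Rightarrow> bool" where
  "local_constraints P x y \<longleftrightarrow> (\<forall>n \<in> nodes P. x n \<in> state_set P n \<and> y n \<in> stage_set P n)"

definition nonanticipativity ::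
  "('n, 'z) ams_data_scheme \<Rightarrow> nat \<times> nat \<Rightarrow> ('n \<Rightarrow> real vec) \<Rightarrow> (nat \<Rightarrow> nat \<Rightarrow> int) \<Rightarrow> bool" where
  "nonanticipativity P = (\<lambda>(t', t) x r.
     \<forall>l \<in> stage_nodes P t. \<forall>m \<in> stage_nodes P t' \<inter> subtree P l.
     \<forall>n \<in> stage_nodes P t' \<inter> subtree P l. \<forall>i < num_states P.
       x m $ i \<ge> x n $ i - state_ub P i * real_of_int (r i t' - r i t) \<and>
       x m $ i \<le> x n $ i + state_ub P i * real_of_int (r i t' - r i t))"

definition revision_constraints ::
  "('n, 'z) ams_data_scheme \<Rightarrow> nat \<Rightarrow> (nat \<Rightarrow> nat \<Rightarrow> int) \<Rightarrow> bool" where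
  "revision_constraints P \<mu> r \<longleftrightarrow>
     (\<forall>i < num_states P.
        (\<forall>t \<in> {1..<stages P}. r i t \<le> r i (t + 1)) \<and>
        r i (stages P) \<le> int \<mu> \<and>
        (\<forall>t \<in> {1..<stages P}. r i (t + 1) - r i t \<le> 1) \<and>
        r i 1 = 0 \<and>
        (\<forall>t \<in> {1..stages P}. r i t \<ge> 0))"

text \<open>A minimization problem in the variables \<open>x, y, r\<close> whose objective does not involve \<open>r\<close>.\<close>

record ('x, 'y, 'r) formulation =
  objective :: "'x \<Rightarrow> 'y \<Rightarrow> real"
  feasible :: "'x \<Rightarrow> 'y \<Rightarrow> 'r \<Rightarrow> bool"

definition equivalent :: "('x, 'y, 'r) formulation \<Rightarrow> ('x, 'y, 'r) formulation \<Rightarrow> bool" where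
  "equivalent F G \<longleftrightarrow> objective F = objective G \<and>
     (\<forall>x y. (\<exists>r. feasible F x y r) \<longleftrightarrow> (\<exists>r. feasible G x y r))"

text \<open>
  The formulation in which non-anticipativity is imposed exactly for the combinations
  \<open>(t', t)\<close> in \<open>K\<close>; \<open>AMS\<close> imposes it for all combinations.
\<close>

definition AMS_on ::
  "('n, 'z) ams_data_scheme \<Rightarrow> nat \<Rightarrow> (nat \<times> nat) set \<Rightarrow>
    ('n \<Rightarrow> real vec, 'n \<Rightarrow> real vec, nat \<Rightarrow> nat \<Rightarrow> int) formulation" where
  "AMS_on P \<mu> K = \<lparr>
     objective = (\<lambda>x y. \<Sum>n \<in> nodes P.
       node_prob P n * (state_cost P n \<bullet> x n + stage_cost P n \<bullet> y n)),
     feasible = (\<lambda>x y r.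
       linear_constraints P x y \<and>
       local_constraints P x y \<and>
       (\<forall>k \<in> K. nonanticipativity P k x r) \<and>
       revision_constraints P \<mu> r) \<rparr>"

definition stage_pairs :: "('n, 'z) tree_scheme \<Rightarrow> (nat \<times> nat) set" where
  "stage_pairs P = {(t', t). t \<in> {1..stages P} \<and> t' \<in> {1..stages P} \<and> t' \<ge> t}"

definition AMS ::
  "('n, 'z) ams_data_scheme \<Rightarrow> nat \<Rightarrow>
    ('n \<Rightarrow> real vec, 'n \<Rightarrow> real vec, nat \<Rightarrow> nat \<Rightarrow> int) formulation" where
  "AMS P \<mu> = AMS_on P \<mu> (stage_pairs P)"

definition redundant :: "('n, 'z) ams_data_scheme \<Rightarrow> nat \<Rightarrow> nat \<times> nat \<Rightarrow> bool" where
  "redundant P \<mu> k \<longleftrightarrow> equivalent (AMS_on P \<mu> (stage_pairs P - {k})) (AMS P \<mu>)"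

end

(* A non-anticipativity constraint (t', t) binds for state i only where r i is constant on
   {t..t'}: as soon as r i increases by one, the bounds on the states imply it. Replacing r i t by
   max (r i t) (mu - T + t) keeps r admissible and creates no new constant interval, since from the
   crossing point on it has slope one. Moreover it lies above mu - T + t and, having
   unit increments from 0, at or below t - 1, so it is constant only on intervals with
   t' - t < T - mu. Hence constraints on longer intervals hold automatically. *)
theory Submission
  imports Defs
begin

text \<open>Since subtraction on naturals truncates, \<mu> \<le> \<open>stages P - 1\<close> gives
  \<mu> < \<open>stages P\<close> only when there is at least one stage; the root provides
  it.\<close>

lemma scenario_tree_stages_pos:
  assumes "scenario_tree P"
  shows "1 \<le> stages P"
proof -
  have "root_node P \<in> path_to P (root_node P)" "finite (path_to P (root_node P))"
    using assms by (auto simp: scenario_tree_def path_to_def)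
  then have "1 \<le> stage P (root_node P)"
    unfolding stage_def by (metis One_nat_def Suc_leI card_gt_0_iff empty_iff)
  then show ?thesis
    using assms unfolding scenario_tree_def by (meson order_trans)
qed

lemma nonanticipativity_iff:
  "nonanticipativity P (t', t) x r \<longleftrightarrow>
     (\<forall>i < num_states P. \<forall>l \<in> stage_nodes P t. \<forall>m \<in> stage_nodes P t' \<inter> subtree P l.
        \<forall>n \<in> stage_nodes P t' \<inter> subtree P l.
          \<bar>x m $ i - x n $ i\<bar> \<le> state_ub P i * real_of_int (r i t' - r i t))"
proof -
  have "\<bar>a - b\<bar> \<le> c \<longleftrightarrow> a \<ge> b - c \<and> a \<le> b + c" for a b c :: real
    by linarith
  then show ?thesis
    unfolding nonanticipativity_def prod.case by blast
qed

text \<open>Both states lie in an interval of length \<open>state_ub P i\<close>. This bound is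
  nonnegative because \<open>x m\<close> meets it, so a factor of at least 1 only weakens
  it.\<close>

lemma state_diff_le_ub:
  assumes "ams_instance P" "local_constraints P x y" "i < num_states P"
    and "m \<in> nodes P" "n \<in> nodes P" "(1::int) \<le> k"
  shows "\<bar>x m $ i - x n $ i\<bar> \<le> state_ub P i * real_of_int k"
proof -
  have bounds: "0 \<le> x p $ i \<and> x p $ i \<le> state_ub P i" if "p \<in> nodes P" for p
    using assms that unfolding ams_instance_def local_constraints_def by blast
  have "\<bar>x m $ i - x n $ i\<bar> \<le> state_ub P i"
    using bounds[OF assms(4)] bounds[OF assms(5)] by linarith
  also have "\<dots> \<le> state_ub P i * real_of_int k"
    using bounds[OF assms(4)] assms(6) by (simp add: mult_le_cancel_left1)
  finally show ?thesis .
qed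

text \<open>Telescoping, confined to \<open>{a..b}\<close> because the revision constraints say
  nothing about \<open>r\<close> outside the stages.\<close>

lemma unit_steps_between:
  fixes r :: "nat \<Rightarrow> int"
  assumes "\<And>t. t \<in> {a..<b} \<Longrightarrow> r t \<le> r (t + 1) \<and> r (t + 1) - r t \<le> 1"
    and "a \<le> s" "s \<le> t" "t \<le> b"
  shows "r s \<le> r t \<and> r t \<le> r s + int (t - s)"
  using assms(3,4)
proof (induction t rule: dec_induct)
  case base
  then show ?case by simp
next
  case (step k)
  then show ?case
    using assms(1)[of k] assms(2) by (simp add: Suc_diff_le)
qed

text \<open>Only the revision variables change while \<open>x\<close> and \<open>y\<close> stay
  fixed, which is the freedom that equivalence leaves.\<close>

lemma short_pairs_suffice:
  assumes inst: "ams_instance P" and \<mu>: "\<mu> < stages P"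
    and loc: "local_constraints P x y"
    and rev: "revision_constraints P \<mu> r"
    and short: "\<And>t t'. (t', t) \<in> stage_pairs P \<Longrightarrow> t' < t + (stages P - \<mu>) \<Longrightarrow>
      nonanticipativity P (t', t) x r"
  obtains r' where "revision_constraints P \<mu> r'"
    and "\<And>k. k \<in> stage_pairs P \<Longrightarrow> nonanticipativity P k x r'"
proof
  define r' where "r' i t = max (r i t) (int \<mu> - int (stages P) + int t)" for i t
  show r'_rev: "revision_constraints P \<mu> r'"
    unfolding revision_constraints_def
  proof (intro allI impI conjI ballI)
    fix i assume i: "i < num_states P"
    note ri = rev[unfolded revision_constraints_def, rule_format, OF i]
    \<comment> \<open>The line inside the maximum reaches \<mu> exactly at the last stage and is at
      most 0 at stage 1, as \<mu> < \<open>stages P\<close>.\<close>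
    show "r' i (stages P) \<le> int \<mu>" "r' i 1 = 0"
      using ri \<mu> by (auto simp: r'_def)
    \<comment> \<open>A maximum of two sequences with increments in [0, 1] again has increments in
      [0, 1].\<close>
    show "r' i t \<le> r' i (t + 1)" "r' i (t + 1) - r' i t \<le> 1" if "t \<in> {1..<stages P}" for t
    proof -
      have "r i t \<le> r i (t + 1)" "r i (t + 1) - r i t \<le> 1"
        using ri that by blast+
      then show "r' i t \<le> r' i (t + 1)" "r' i (t + 1) - r' i t \<le> 1"
        by (auto simp: r'_def)
    qed
    show "r' i t \<ge> 0" if "t \<in> {1..stages P}" for t
      using ri that by (auto simp: r'_def le_max_iff_disj)
  qed
  have between: "r i s \<le> r i t" "r i t \<le> r i s + int (t - s)" "r' i s \<le> r' i t"
      "r i s \<le> int s - 1" "r' i s \<le> int s - 1"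
    if "i < num_states P" "1 \<le> s" "s \<le> t" "t \<le> stages P" for i s t
    using unit_steps_between[of 1 "stages P" "r i" s t] unit_steps_between[of 1 "stages P" "r' i" s t]
      unit_steps_between[of 1 "stages P" "r i" 1 s] unit_steps_between[of 1 "stages P" "r' i" 1 s]
      rev r'_rev that
    by (auto simp: revision_constraints_def)
  show "nonanticipativity P k x r'" if pair: "k \<in> stage_pairs P" for k
  proof -
    obtain t' t where k: "k = (t', t)"
      by (cases k)
    with pair have tt: "1 \<le> t" "t \<le> t'" "t' \<le> stages P"
      by (simp_all add: stage_pairs_def)
    show ?thesis
      unfolding k nonanticipativity_iff
    proof (intro allI impI ballI)
      fix i l m n
      assume i: "i < num_states P" and l: "l \<in> stage_nodes P t"
        and m: "m \<in> stage_nodes P t' \<inter> subtree P l" and n: "n \<in> stage_nodes P t' \<inter> subtree P l"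
      show "\<bar>x m $ i - x n $ i\<bar> \<le> state_ub P i * real_of_int (r' i t' - r' i t)"
      \<comment> \<open>By integrality and monotonicity, \<open>r'\<close> either grows by at least
        1 or is flat between the two stages.\<close>
      proof (cases "1 \<le> r' i t' - r' i t")
        case True
        with m n show ?thesis
          by (intro state_diff_le_ub[OF inst loc i]) (auto simp: stage_nodes_def)
      next
        case False
        with between[OF i tt] have flat: "r' i t' = r' i t" by linarith
        \<comment> \<open>Combine \<mu> - T + t' \<le> \<open>r' i t'\<close> =
          \<open>r' i t\<close> \<le> t - 1, where T is \<open>stages P\<close>.\<close>
        then have "t' < t + (stages P - \<mu>)"
          using between(5)[OF i tt] \<mu> by (auto simp: r'_def max_def split: if_splits)
        then have "nonanticipativity P (t', t) x r"
          using short pair k by simp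
        \<comment> \<open>For t < t' the linear term grows strictly, so flatness forces
          \<open>r' i t = r i t\<close>; then \<open>r i t' \<le> r' i t' = r i t\<close>, and
          monotonicity of \<open>r i\<close> gives equality.\<close>
        moreover have "r i t' = r i t"
          using flat between[OF i tt] tt by (auto simp: r'_def max_def split: if_splits)
        ultimately have "r i t' - r i t = r' i t' - r' i t"
            and "\<bar>x m $ i - x n $ i\<bar> \<le> state_ub P i * real_of_int (r i t' - r i t)"
          using i l m n flat unfolding nonanticipativity_iff by (simp, blast)
        then show ?thesis
          by (simp only:)
      qed
    qed
  qed
qed

text \<open>Leaving \<open>K\<close> arbitrary above the short pairs covers both the deletion of one
  long pair and the deletion of all of them.\<close>

lemma equivalent_if_short_pairs:
  assumes "ams_instance P" "\<mu> < stages P" "K \<subseteq> stage_pairs P"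
    and "\<And>t t'. (t', t) \<in> stage_pairs P \<Longrightarrow> t' < t + (stages P - \<mu>) \<Longrightarrow> (t', t) \<in> K"
  shows "equivalent (AMS_on P \<mu> K) (AMS P \<mu>)"
proof -
  have "\<exists>r'. feasible (AMS P \<mu>) x y r'" if "feasible (AMS_on P \<mu> K) x y r" for x y r
  proof -
    from that assms(4) obtain r' where "revision_constraints P \<mu> r'"
      "\<And>k. k \<in> stage_pairs P \<Longrightarrow> nonanticipativity P k x r'"
      using short_pairs_suffice[OF assms(1,2), of x y r] unfolding AMS_on_def by auto
    with that show ?thesis
      unfolding AMS_def AMS_on_def by simp blast
  qed
  \<comment> \<open>Fewer constraints: the same \<open>r\<close> works.\<close>
  moreover have "feasible (AMS_on P \<mu> K) x y r" if "feasible (AMS P \<mu>) x y r" for x y r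
    using that assms(3) unfolding AMS_def AMS_on_def by auto
  moreover have "objective (AMS_on P \<mu> K) = objective (AMS P \<mu>)"
    by (simp add: AMS_def AMS_on_def)
  ultimately show ?thesis
    unfolding equivalent_def by blast
qed

theorem proposition7:
  fixes P :: "'n ams_data" and \<mu> :: nat
  assumes "ams_instance P"
    and "\<mu> \<in> {0..stages P - 1}"
  shows "(\<forall>t \<in> {1..stages P}. \<forall>t' \<in> {1..stages P}.
           t' \<ge> t \<longrightarrow> t' > t + (stages P - \<mu>) - 1 \<longrightarrow> redundant P \<mu> (t', t)) \<and>
         equivalent
           (AMS_on P \<mu> {(t', t). t \<in> {1..stages P} \<and>
              min (t + (stages P - \<mu>) - 1) (stages P) \<ge> t' \<and> t' \<ge> t})
           (AMS P \<mu>)"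
proof -
  have \<mu>: "\<mu> < stages P"
    using assms scenario_tree_stages_pos[of P] by (auto simp: ams_instance_def)
  \<comment> \<open>As t \<ge> 1, the bound t' \<le> \<open>t + (stages P - \<mu>) - 1\<close> is
    the strict inequality that defines short pairs, without truncation.\<close>
  show ?thesis
    unfolding redundant_def
    by (intro conjI ballI impI equivalent_if_short_pairs[OF assms(1) \<mu>])
      (auto simp: stage_pairs_def)
qed

end
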